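(* Let $n\ge 3$ be an integer, let $\gamma=0$ if $n$ is even and $\gamma=1$ if $n$ is odd, and let $H_n^4$ be any graph in $\mathscr{H}_n^4$. Then for every integer $h$ with $1\le h\le 2^{\lceil n/2\rceil}-2-\gamma$, $$\lambda_h(H_n^4)=\xi_h(H_n^4).$$
   Context: The family $\mathscr{H}_n^4$ ($n\ge 2$) of $n$-dimensional $K_4$-hypercubes is defined recursively: $\mathscr{H}_2^4=\{K_4\}$; for $n\ge 3$, a graph belongs to $\mathscr{H}_n^4$ if and only if (up to isomorphism) it is obtained from two vertex-disjoint graphs $G_0,G_1\in\mathscr{H}_{n-1}^4$ (not necessarily isomorphic) by adding an arbitrary perfect matching between $V(G_0)$ and $V(G_1)$. Each member of $\mathscr{H}_n^4$ is $(n+1)$-regular with $2^n$ vertices. For a graph $G$ and $X\subseteq V(G)$, $\overline{X}=V(G)\setminus X$ and $[X,\overline{X}]$ is the set of edges with exactly one end in $X$. For $1\le m\le\lfloor |V(G)|/2\rfloor$, $\xi_m(G)=\min\{|[X,\overline{X}]| : |X|=m,\ G[X]\text{ and }G[\overline{X}]\text{ both connected}\}$. For a connected graph $G$ and integer $h\ge1$, the $h$-extra edge-connectivity $\lambda_h(G)$ is the minimum size of an edge set $F\subseteq E(G)$ such that $G-F$ is disconnected and every component of $G-F$ has at least $h$ vertices. *)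

theory Defs
  imports Complex_Main
begin

text \<open>
  A finite simple graph is given by its vertex set \<open>V\<close> and its edge set \<open>E\<close>, a set of
  two-element subsets of \<open>V\<close>.
\<close>

definition all_edges :: "'a set \<Rightarrow> 'a set set" where
  "all_edges V = {e. e \<subseteq> V \<and> card e = 2}"

definition induced_edges :: "'a set set \<Rightarrow> 'a set \<Rightarrow> 'a set set" where
  "induced_edges E X = {e \<in> E. e \<subseteq> X}"

definition adjacency :: "'a set set \<Rightarrow> ('a \<times> 'a) set" where
  "adjacency E = {(u, v). {u, v} \<in> E}"

definition reachable :: "'a set \<Rightarrow> 'a set set \<Rightarrow> ('a \<times> 'a) set" where
  "reachable V E = {(u, v). u \<in> V \<and> v \<in> V \<and> (u, v) \<in> (adjacency E)\<^sup>*}"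

definition graph_connected :: "'a set \<Rightarrow> 'a set set \<Rightarrow> bool" where
  "graph_connected V E \<longleftrightarrow> V \<noteq> {} \<and> (\<forall>u \<in> V. \<forall>v \<in> V. (u, v) \<in> reachable V E)"

text \<open>Components are represented by their vertex sets.\<close>

definition graph_components :: "'a set \<Rightarrow> 'a set set \<Rightarrow> 'a set set" where
  "graph_components V E = V // reachable V E"

definition perfect_matching_between :: "'a set \<Rightarrow> 'a set \<Rightarrow> 'a set set \<Rightarrow> bool" where
  "perfect_matching_between A B M \<longleftrightarrow>
     M \<subseteq> {{a, b} | a b. a \<in> A \<and> b \<in> B} \<and> (\<forall>v \<in> A \<union> B. \<exists>!e. e \<in> M \<and> v \<in> e)"

text \<open>
  \<open>K4_hypercube n V E\<close> says that the graph with vertex set \<open>V\<close> and edge set \<open>E\<close> is an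
  \<open>n\<close>-dimensional \<open>K\<^sub>4\<close>-hypercube. Closure under isomorphism needs no separate rule, since the
  vertex set is an arbitrary four-element set in the base case.
\<close>

inductive K4_hypercube :: "nat \<Rightarrow> 'a set \<Rightarrow> 'a set set \<Rightarrow> bool" where
  base: "card V = 4 \<Longrightarrow> K4_hypercube 2 V (all_edges V)"
| step: "\<lbrakk>K4_hypercube n V0 E0; K4_hypercube n V1 E1; V0 \<inter> V1 = {};
          perfect_matching_between V0 V1 M\<rbrakk>
         \<Longrightarrow> K4_hypercube (Suc n) (V0 \<union> V1) (E0 \<union> E1 \<union> M)"

definition edge_boundary :: "'a set set \<Rightarrow> 'a set \<Rightarrow> 'a set set" where
  "edge_boundary E X = {e \<in> E. card (e \<inter> X) = 1}"

definition xi_feasible :: "nat \<Rightarrow> 'a set \<Rightarrow> 'a set set \<Rightarrow> 'a set \<Rightarrow> bool" where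
  "xi_feasible m V E X \<longleftrightarrow>
     X \<subseteq> V \<and> card X = m \<and>
     graph_connected X (induced_edges E X) \<and>
     graph_connected (V - X) (induced_edges E (V - X))"

definition extra_edge_cut :: "nat \<Rightarrow> 'a set \<Rightarrow> 'a set set \<Rightarrow> 'a set set \<Rightarrow> bool" where
  "extra_edge_cut h V E F \<longleftrightarrow>
     F \<subseteq> E \<and> \<not> graph_connected V (E - F) \<and>
     (\<forall>C \<in> graph_components V (E - F). h \<le> card C)"

text \<open>
  The infimum of a nonempty set of natural numbers is attained, so both definitions are minima
  whenever a feasible object exists; on the empty set the infimum is \<open>0\<close> by convention.
\<close>

definition xi :: "nat \<Rightarrow> 'a set \<Rightarrow> 'a set set \<Rightarrow> nat" where
  "xi m V E = Inf {card (edge_boundary E X) | X. xi_feasible m V E X}"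

definition extra_edge_connectivity :: "nat \<Rightarrow> 'a set \<Rightarrow> 'a set set \<Rightarrow> nat" where
  "extra_edge_connectivity h V E = Inf {card F | F. extra_edge_cut h V E F}"

end

theory Submission
  imports Defs
begin

text \<open>
  Adding vertices block by block, the \<open>i\<close>-th new vertex of a \<open>K\<^sub>4\<close>-hypercube sees at most
  \<open>i mod 4\<close> earlier vertices inside its own \<open>K\<^sub>4\<close> and one for each binary digit \<open>1\<close> of
  \<open>i div 4\<close>. Summing these numbers \<open>s i\<close> over \<open>i < m\<close> gives the largest number \<open>f m\<close> of edges spanned by
  \<open>m\<close> vertices, and an initial segment attaining it can be chosen connected with connected
  complement. By regularity \<open>\<xi>\<^sub>m = g m\<close> with \<open>g m = (n + 1) m - 2 f m\<close>. On the other hand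
  an \<open>h\<close>-extra edge cut contains the boundary of a set of \<open>m\<close> vertices with
  \<open>h \<le> m \<le> 2\<^sup>n\<^sup>-\<^sup>1\<close>, so it remains to see that \<open>g h \<le> g m\<close>. The increments
  \<open>n + 1 - 2 s i\<close> of \<open>g\<close> are nonnegative up to \<open>m = 2\<^sup>c - 1\<close> with
  \<open>c = \<lceil>n / 2\<rceil>\<close>, the next step loses at most \<open>1 + \<gamma>\<close>, which is exactly what the bound on \<open>h\<close>
  compensates, and for \<open>2\<^sup>k \<le> m \<le> 2\<^sup>k\<^sup>+\<^sup>1\<close> with \<open>k \<ge> c\<close> one has
  \<open>g m \<ge> g (2\<^sup>k) = 2\<^sup>k (n - k) \<ge> g (2\<^sup>c)\<close>.
\<close>

section \<open>The extremal edge count\<close>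

fun digit_sum :: "nat \<Rightarrow> nat" where
  "digit_sum n = (if n = 0 then 0 else n mod 2 + digit_sum (n div 2))"

declare digit_sum.simps [simp del]

definition back_degree :: "nat \<Rightarrow> nat" where
  "back_degree i = i mod 4 + digit_sum (i div 4)"

definition max_edges :: "nat \<Rightarrow> nat" where
  "max_edges m = (\<Sum>i<m. back_degree i)"

lemma digit_sum_0 [simp]: "digit_sum 0 = 0"
  by (simp add: digit_sum.simps)

lemma digit_sum_power_add: "q < 2 ^ k \<Longrightarrow> digit_sum (2 ^ k + q) = Suc (digit_sum q)"
proof (induction k arbitrary: q)
  case 0
  then show ?case by (simp add: digit_sum.simps)
next
  case (Suc k)
  have "q div 2 < 2 ^ k" using Suc.prems by auto
  then have "digit_sum ((2 ^ Suc k + q) div 2) = Suc (digit_sum (q div 2))"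
    using Suc.IH by simp
  then show ?case
    by (subst digit_sum.simps, subst (2) digit_sum.simps) auto
qed

lemma back_degree_less_4: "i < 4 \<Longrightarrow> back_degree i = i"
  by (simp add: back_degree_def)

text \<open>As \<open>4\<close> divides \<open>2 ^ k\<close>, only the quotient by \<open>4\<close>
  changes, gaining a leading digit. The extra \<open>1\<close> stands for the matching edge of a
  vertex in the second of two halves.\<close>

lemma back_degree_power_add:
  assumes "2 \<le> k" "j < 2 ^ k"
  shows "back_degree (2 ^ k + j) = Suc (back_degree j)"
proof -
  obtain k' where k: "k = k' + 2" using assms(1) by (metis add.commute le_Suc_ex)
  have "j div 4 < 2 ^ k'" using assms(2) k by auto
  moreover have "(2 ^ k + j) div 4 = 2 ^ k' + j div 4" "(2 ^ k + j) mod 4 = j mod 4"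
    using k by auto
  ultimately show ?thesis
    by (simp add: back_degree_def digit_sum_power_add)
qed

section \<open>Block recursion, complement symmetry and superadditivity\<close>

lemma max_edges_0 [simp]: "max_edges 0 = 0"
  and max_edges_Suc: "max_edges (Suc m) = max_edges m + back_degree m"
  by (simp_all add: max_edges_def)

lemma max_edges_le_4: "m \<le> 4 \<Longrightarrow> max_edges m = m choose 2"
proof (induction m)
  case (Suc m)
  then show ?case
    by (simp add: max_edges_Suc back_degree_less_4 numeral_2_eq_2)
qed simp

text \<open>Sums the extra \<open>1\<close> of each of the last \<open>j\<close> vertices: a full
  half sends \<open>j\<close> matching edges to \<open>j\<close> vertices of the other half.\<close>

lemma max_edges_power_add:
  "2 \<le> k \<Longrightarrow> j \<le> 2 ^ k \<Longrightarrow> max_edges (2 ^ k + j) = max_edges (2 ^ k) + max_edges j + j"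
  by (induction j) (simp_all add: max_edges_Suc back_degree_power_add)

lemma max_edges_power: "2 \<le> k \<Longrightarrow> 2 * max_edges (2 ^ k) = (k + 1) * 2 ^ k"
proof (induction k rule: nat_induct_at_least)
  case base
  then show ?case by (simp add: max_edges_le_4 choose_two)
next
  case (Suc k)
  then show ?case
    using max_edges_power_add[of k "2 ^ k"] by (simp add: mult_2 algebra_simps)
qed

text \<open>In a \<open>(k + 1)\<close>-regular graph on \<open>2 ^ k\<close> vertices a set and its
  complement have the same boundary; this is that symmetry for the extremal counts, with
  subtractions cleared. The larger part contains a half, and its excess is complementary to the
  smaller part in the other half, which gives the induction.\<close>

lemma max_edges_complement:
  "2 \<le> k \<Longrightarrow> x + y = 2 ^ k \<Longrightarrow>
    (k + 1) * x + 2 * max_edges y = (k + 1) * y + 2 * max_edges x"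
proof (induction k arbitrary: x y rule: nat_induct_at_least)
  case base
  then have "x \<in> {0, 1, 2, 3, 4}" "y = 4 - x" by auto
  then show ?case by (auto simp: max_edges_le_4 choose_two)
next
  case (Suc k)
  have *: "(Suc k + 1) * x + 2 * max_edges y = (Suc k + 1) * y + 2 * max_edges x"
    if xy: "x + y = 2 ^ Suc k" and le: "x \<le> y" for x y
  proof -
    obtain z where z: "y = 2 ^ k + z" "x + z = 2 ^ k"
      using xy le that[of "y - 2 ^ k"] by simp
    then show ?thesis
      using Suc.IH[OF z(2)] max_edges_power[OF Suc.hyps] max_edges_power_add[OF Suc.hyps, of z]
      by (simp add: algebra_simps)
  qed
  show ?case
    using *[of x y] *[of y x] Suc.prems by (cases "x \<le> y") (auto simp: add.commute)
qed

text \<open>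
  Splitting at the power of two \<open>K\<close> with \<open>K < a + b \<le> 2 K\<close>, either \<open>K \<le> a\<close> and a block is
  removed, or both parts are below \<open>K\<close> and are replaced by their complements in \<open>K\<close>.
\<close>

lemma max_edges_superadditive:
  "b \<le> a \<Longrightarrow> max_edges a + max_edges b + b \<le> max_edges (a + b)"
proof (induction "a + b" arbitrary: a b rule: less_induct)
  case less
  show ?case
  proof (cases "a + b \<le> 4")
    case True
    then have "(a, b) \<in> {(0,0),(1,0),(2,0),(3,0),(4,0),(1,1),(2,1),(3,1),(2,2)}"
      using less.prems by simp presburger
    then show ?thesis by (auto simp: max_edges_le_4 choose_two)
  next
    case False
    have "\<exists>k. 2 ^ k < a + b \<and> a + b \<le> 2 ^ Suc k"
    proof -
      define j where "j = (LEAST j. a + b \<le> 2 ^ j)"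
      have j: "a + b \<le> 2 ^ j"
        unfolding j_def by (rule LeastI[of _ "a + b"]) (simp add: less_imp_le)
      then have "j \<noteq> 0" using False by (metis one_le_numeral order_trans power_0)
      then obtain k where k: "j = Suc k" using not0_implies_Suc by blast
      then have "\<not> a + b \<le> 2 ^ k"
        unfolding j_def by (metis lessI not_less_Least)
      with j k show ?thesis by (intro exI[of _ k]) simp
    qed
    then obtain k where k: "2 ^ k < a + b" "a + b \<le> 2 ^ Suc k" by blast
    have "2 \<le> k"
    proof (rule ccontr)
      assume "\<not> 2 \<le> k"
      then have "Suc k \<le> 2" by simp
      then have "(2::nat) ^ Suc k \<le> 2 ^ 2" by (intro power_increasing) auto
      with k False show False by simp
    qed
    show ?thesis
    proof (cases "2 ^ k \<le> a")
      case True
      then obtain j where j: "a = 2 ^ k + j" by (metis le_Suc_ex)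
      \<comment> \<open>Splitting the block off \<open>a\<close> and \<open>a + b\<close> yields the
        summands \<open>j\<close> and \<open>j + b\<close>, whose difference is the term
        \<open>b\<close> of the claim. What remains is superadditivity for \<open>j\<close> and
        \<open>b\<close>.\<close>
      have "max_edges j + max_edges b \<le> max_edges (j + b)"
      proof (cases "b \<le> j")
        case True
        then show ?thesis using less.hyps[of j b] j by simp
      next
        case False
        then show ?thesis using less.hyps[of b j] j by (simp add: add.commute)
      qed
      moreover have "max_edges (2 ^ k + (j + b)) = max_edges (2 ^ k) + max_edges (j + b) + (j + b)"
        "max_edges (2 ^ k + j) = max_edges (2 ^ k) + max_edges j + j"
        using k j \<open>2 \<le> k\<close> by (intro max_edges_power_add; simp)+
      ultimately show ?thesis using j by (simp add: add.assoc)
    next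
      case False
      \<comment> \<open>\<open>x\<close> and \<open>y\<close> are the complements of
        \<open>a\<close> and \<open>b\<close> in the block, and \<open>j\<close> is that of
        \<open>x + y\<close>. Since \<open>x + y < 2 ^ k < a + b\<close>, the induction hypothesis
        applies to \<open>y\<close> and \<open>x\<close>.\<close>
      define x y j where "x = 2 ^ k - a" and "y = 2 ^ k - b" and "j = a + b - 2 ^ k"
      have xy: "x + a = 2 ^ k" "y + b = 2 ^ k" "a + b = 2 ^ k + j" "(x + y) + j = 2 ^ k"
        using False less.prems k by (auto simp: x_def y_def j_def)
      have "max_edges y + max_edges x + x \<le> max_edges (y + x)"
        using xy less.prems k by (intro less.hyps) auto
      moreover note max_edges_complement[OF \<open>2 \<le> k\<close> xy(1)]
        max_edges_complement[OF \<open>2 \<le> k\<close> xy(2)] max_edges_complement[OF \<open>2 \<le> k\<close> xy(4)]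
        max_edges_power[OF \<open>2 \<le> k\<close>]
      moreover have "max_edges (a + b) = max_edges (2 ^ k) + max_edges j + j"
        unfolding xy(3) using xy by (intro max_edges_power_add \<open>2 \<le> k\<close>) simp
      moreover have "(k + 1) * x + (k + 1) * a = (k + 1) * 2 ^ k"
        "(k + 1) * y + (k + 1) * b = (k + 1) * 2 ^ k"
        "(k + 1) * (x + y) + (k + 1) * j = (k + 1) * 2 ^ k"
        "(k + 1) * (x + y) = (k + 1) * x + (k + 1) * y"
        using xy by (metis distrib_left)+
      \<comment> \<open>The \<open>j\<close> from expanding \<open>max_edges (a + b)\<close> and the
        \<open>x\<close> from the induction hypothesis together make up the required
        \<open>b\<close>.\<close>
      moreover have "j + x = b" using xy by linarith
      ultimately show ?thesis unfolding add.commute[of y x] by linarith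
    qed
  qed
qed

section \<open>Monotonicity of the boundary function\<close>

text \<open>The value \<open>k + 1\<close> belongs to \<open>k\<close> binary digits all equal to
  \<open>1\<close>, that is to the last index \<open>2 ^ k - 1\<close>; every digit \<open>0\<close>
  costs at least \<open>1\<close>.\<close>

lemma back_degree_le:
  "2 \<le> k \<Longrightarrow> i < 2 ^ k \<Longrightarrow> back_degree i \<le> Suc k \<and> (Suc i < 2 ^ k \<longrightarrow> back_degree i \<le> k)"
proof (induction k arbitrary: i rule: nat_induct_at_least)
  case base
  then show ?case by (auto simp: back_degree_less_4)
next
  case (Suc k)
  show ?case
  proof (cases "i < 2 ^ k")
    case True
    then show ?thesis using Suc.IH by fastforce
  next
    case False
    then obtain j where "i = 2 ^ k + j" by (metis le_Suc_ex not_le)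
    then show ?thesis
      using Suc.IH[of j] Suc.prems Suc.hyps by (auto simp: back_degree_power_add)
  qed
qed

text \<open>In binary, \<open>2 ^ k - 3\<close> is \<open>k - 2\<close> ones followed by
  \<open>01\<close>. The exact value serves odd \<open>n\<close>, where \<open>h\<close> may reach
  \<open>2 ^ c - 3\<close>.\<close>

lemma back_degree_power_minus:
  assumes "2 \<le> k"
  shows "back_degree (2 ^ k - 3) = k - 1"
  using assms
proof (induction k rule: nat_induct_at_least)
  case base
  then show ?case by (simp add: back_degree_less_4)
next
  case (Suc k)
  \<comment> \<open>Keeps the natural subtraction of \<open>3\<close> from being truncated.\<close>
  have "(2::nat) ^ 2 \<le> 2 ^ k" using Suc.hyps by (intro power_increasing) auto
  then have "2 ^ Suc k - 3 = (2::nat) ^ k + (2 ^ k - 3)" by simp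
  then show ?case
    using Suc back_degree_power_add[of k "2 ^ k - 3"] by simp
qed

text \<open>Average degree cannot exceed the degree \<open>k + 1\<close> of the block. Numerically,
  superadditivity bounds the sum of the counts of \<open>j\<close> and its complement
  \<open>i\<close>, while the complement identity fixes their difference.\<close>

lemma max_edges_le:
  assumes "2 \<le> k" "j \<le> 2 ^ k"
  shows "2 * max_edges j \<le> (k + 1) * j"
proof -
  obtain i where i: "j + i = 2 ^ k" using assms(2) le_Suc_ex by metis
  have "max_edges j + max_edges i + min i j \<le> max_edges (2 ^ k)"
    using max_edges_superadditive[of i j] max_edges_superadditive[of j i] i
    by (cases "i \<le> j") (auto simp: add.commute)
  moreover have "(k + 1) * j + (k + 1) * i = (k + 1) * 2 ^ k"
    using i by (metis distrib_left)
  ultimately show ?thesis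
    using max_edges_complement[OF assms(1) i] max_edges_power[OF assms(1)] by linarith
qed

text \<open>The function \<open>g\<close> for a general degree \<open>d\<close>, taken in
  \<open>int\<close> because its increments change sign.\<close>

definition min_boundary :: "nat \<Rightarrow> nat \<Rightarrow> int" where
  "min_boundary d m = int d * int m - 2 * int (max_edges m)"

lemma min_boundary_Suc: "min_boundary d (Suc m) = min_boundary d m + (int d - 2 * int (back_degree m))"
  by (simp add: min_boundary_def max_edges_Suc algebra_simps)

lemma min_boundary_power:
  assumes "2 \<le> k"
  shows "min_boundary (n + 1) (2 ^ k) = 2 ^ k * (int n - int k)"
proof -
  have "int (2 * max_edges (2 ^ k)) = int ((k + 1) * 2 ^ k)"
    using max_edges_power[OF assms] by presburger
  then show ?thesis by (simp add: min_boundary_def algebra_simps)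
qed

text \<open>With \<open>m = 2 ^ k + j\<close> the difference is
  \<open>(n + 1) j - 2 max_edges j - 2 j\<close>, which is at least
  \<open>(n - k - 2) j\<close>.\<close>

lemma min_boundary_ge_power:
  assumes "2 \<le> k" "k + 2 \<le> n" "2 ^ k \<le> m" "m \<le> 2 ^ Suc k"
  shows "min_boundary (n + 1) (2 ^ k) \<le> min_boundary (n + 1) m"
proof -
  obtain j where j: "m = 2 ^ k + j" using assms(3) le_Suc_ex by blast
  then have "j \<le> 2 ^ k" using assms(4) by simp
  then have "max_edges m = max_edges (2 ^ k) + max_edges j + j" "2 * max_edges j \<le> (k + 1) * j"
    using j assms(1) max_edges_power_add max_edges_le by auto
  moreover have "(k + 1) * j + 2 * j \<le> (n + 1) * j"
    using assms(2) by (metis add_le_mono1 add.commute add.left_commute distrib_right mult_le_mono1)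
  ultimately have "(n + 1) * 2 ^ k + 2 * max_edges m \<le> (n + 1) * m + 2 * max_edges (2 ^ k)"
    using j by (simp add: distrib_left)
  then have "int ((n + 1) * 2 ^ k + 2 * max_edges m) \<le> int ((n + 1) * m + 2 * max_edges (2 ^ k))"
    by (simp only: of_nat_le_iff)
  then show ?thesis by (simp only: min_boundary_def of_nat_add of_nat_mult of_nat_numeral)
qed

text \<open>Each step compares \<open>2 ^ k (n - k)\<close> with
  \<open>2 ^ (k + 1) (n - k - 1)\<close>, and \<open>n - k \<le> 2 (n - k - 1)\<close> as soon as
  \<open>n - k \<ge> 2\<close>.\<close>

lemma min_boundary_power_mono:
  assumes "2 \<le> c" "c \<le> k" "k < n"
  shows "min_boundary (n + 1) (2 ^ c) \<le> min_boundary (n + 1) (2 ^ k)"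
  using assms(2,3)
proof (induction k rule: dec_induct)
  case (step k)
  have "(2::int) ^ k * (int n - int k) \<le> 2 ^ k * (2 * (int n - int (Suc k)))"
    using step by (intro mult_left_mono) auto
  then show ?case
    using step assms(1) min_boundary_power[of k n] min_boundary_power[of "Suc k" n]
    by (simp add: algebra_simps)
qed simp

lemma min_boundary_ge_power_beyond:
  assumes "2 \<le> c" "2 ^ c \<le> m" "m \<le> 2 ^ k" "c \<le> k" "k < n"
  shows "min_boundary (n + 1) (2 ^ c) \<le> min_boundary (n + 1) m"
  using assms(4,3,5)
proof (induction k rule: dec_induct)
  case base
  then show ?case using assms(2) by simp
next
  case (step k)
  show ?case
  proof (cases "m \<le> 2 ^ k")
    case True
    then show ?thesis using step by simp
  next
    case False
    then have "min_boundary (n + 1) (2 ^ k) \<le> min_boundary (n + 1) m"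
      using step assms(1) by (intro min_boundary_ge_power) auto
    then show ?thesis
      using min_boundary_power_mono[of c k n] step assms(1) by simp
  qed
qed

lemma min_boundary_mono_below:
  assumes "2 \<le> c" "2 * c \<le> d" "i \<le> j" "j < 2 ^ c"
  shows "min_boundary d i \<le> min_boundary d j"
  using assms(3,4)
proof (induction j rule: dec_induct)
  case (step j)
  \<comment> \<open>\<open>Suc j < 2 ^ c\<close> excludes the last index of the block, so the
    increment is at least \<open>d - 2 * c \<ge> 0\<close>.\<close>
  then have "back_degree j \<le> c" using back_degree_le[OF assms(1), of j] by simp
  then show ?case using step assms(2) by (simp add: min_boundary_Suc)
qed simp

text \<open>The values rise up to \<open>2 ^ c - 1\<close>, and from \<open>2 ^ c\<close> to
  \<open>2 ^ (n - 1)\<close> they never fall below the one at \<open>2 ^ c\<close>. So the case left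
  is the comparison of \<open>h\<close> with \<open>2 ^ c\<close>, where the bound on
  \<open>h\<close> enters.\<close>

lemma min_boundary_mono:
  assumes n: "3 \<le> n" and c: "c = (n + 1) div 2"
    and h: "h + 2 + n mod 2 \<le> 2 ^ c" and m: "h \<le> m" "m \<le> 2 ^ (n - 1)"
  shows "min_boundary (n + 1) h \<le> min_boundary (n + 1) m"
proof -
  have c2: "2 \<le> c" and cn: "c < n" "2 * c \<le> n + 1" using n c by auto
  have pow: "(2::nat) ^ 2 \<le> 2 ^ c" using c2 by (intro power_increasing) auto
  have peak: "min_boundary (n + 1) h \<le> min_boundary (n + 1) (2 ^ c)"
  proof -
    have eqs: "Suc (2 ^ c - 3) = 2 ^ c - 2" "Suc (2 ^ c - 2) = 2 ^ c - 1" "Suc (2 ^ c - 1) = (2::nat) ^ c"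
      using pow by auto
    have b: "back_degree (2 ^ c - 1) \<le> Suc c" "back_degree (2 ^ c - 2) \<le> c"
      using back_degree_le[OF c2, of "2 ^ c - 1"] back_degree_le[OF c2, of "2 ^ c - 2"] pow by auto
    note s = min_boundary_Suc[of "n + 1" "2 ^ c - 3", unfolded eqs back_degree_power_minus[OF c2]]
      min_boundary_Suc[of "n + 1" "2 ^ c - 2", unfolded eqs]
      min_boundary_Suc[of "n + 1" "2 ^ c - 1", unfolded eqs]
    show ?thesis
    proof (cases "even n")
      case True
      \<comment> \<open>The last two increments before \<open>2 ^ c\<close> are at least
        \<open>1\<close> and \<open>-1\<close>, so nothing is lost from \<open>2 ^ c - 2\<close>
        on.\<close>
      then have "n = 2 * c" using c by auto
      moreover have "min_boundary (n + 1) h \<le> min_boundary (n + 1) (2 ^ c - 2)"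
        using h pow cn by (intro min_boundary_mono_below[OF c2]) auto
      ultimately show ?thesis using b s by linarith
    next
      case False
      \<comment> \<open>The last three increments before \<open>2 ^ c\<close> are \<open>2\<close>,
        at least \<open>0\<close> and at least \<open>-2\<close>; hence the start at
        \<open>2 ^ c - 3\<close>.\<close>
      then have "n + 1 = 2 * c" using c by auto
      moreover have "n mod 2 = 1" using False by presburger
      then have "min_boundary (n + 1) h \<le> min_boundary (n + 1) (2 ^ c - 3)"
        using h pow cn by (intro min_boundary_mono_below[OF c2]) auto
      ultimately show ?thesis using b s c2 by linarith
    qed
  qed
  show ?thesis
  proof (cases "m < 2 ^ c")
    case True
    then show ?thesis using min_boundary_mono_below[OF c2 cn(2) m(1)] by simp
  next
    case False
    moreover have "c \<le> n - 1" "n - 1 < n" using cn by auto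
    ultimately show ?thesis
      using min_boundary_ge_power_beyond[of c m "n - 1" n] peak c2 m by linarith
  qed
qed

section \<open>Connectivity\<close>

lemma graph_connected_mono:
  assumes "graph_connected V E" "E \<subseteq> E'"
  shows "graph_connected V E'"
proof -
  have "adjacency E \<subseteq> adjacency E'" using assms(2) by (auto simp: adjacency_def)
  then show ?thesis
    using assms(1) rtrancl_mono[of "adjacency E" "adjacency E'"]
    by (auto simp: graph_connected_def reachable_def)
qed

lemma sym_adjacency: "sym (adjacency E)"
  by (auto simp: sym_def adjacency_def insert_commute)

lemma equiv_reachable: "equiv V (reachable V E)"
proof (rule equivI)
  show "refl_on V (reachable V E)" by (auto simp: refl_on_def reachable_def)
  show "sym (reachable V E)"
    using sym_rtrancl[OF sym_adjacency, of E] by (auto simp: sym_def reachable_def)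
  show "trans (reachable V E)" by (auto simp: trans_def reachable_def)
  show "reachable V E \<subseteq> V \<times> V" by (auto simp: reachable_def)
qed

lemma graph_connected_Un:
  assumes "graph_connected A E" and nbr: "\<And>b. b \<in> B \<Longrightarrow> \<exists>a\<in>A. {b, a} \<in> E"
  shows "graph_connected (A \<union> B) E"
proof -
  obtain r where r: "r \<in> A" using assms(1) by (auto simp: graph_connected_def)
  have to_r: "(u, r) \<in> (adjacency E)\<^sup>*" if "u \<in> A \<union> B" for u
  proof (cases "u \<in> A")
    case True
    then show ?thesis using assms(1) r by (auto simp: graph_connected_def reachable_def)
  next
    case False
    then have "\<exists>a\<in>A. {u, a} \<in> E" using nbr that by blast
    then obtain a where a: "a \<in> A" "(u, a) \<in> adjacency E"
      by (auto simp: adjacency_def)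
    then have "(a, r) \<in> (adjacency E)\<^sup>*"
      using assms(1) r by (auto simp: graph_connected_def reachable_def)
    with a(2) show ?thesis by (rule converse_rtrancl_into_rtrancl)
  qed
  have "(u, v) \<in> (adjacency E)\<^sup>*" if "u \<in> A \<union> B" "v \<in> A \<union> B" for u v
    using to_r[OF that(1)] to_r[OF that(2)] sym_rtrancl[OF sym_adjacency, of E]
    by (meson rtrancl_trans symD)
  then show ?thesis using r by (auto simp: graph_connected_def reachable_def)
qed

lemma graph_connected_complete:
  assumes "X \<noteq> {}"
  shows "graph_connected X (all_edges X)"
proof -
  have "(u, v) \<in> (adjacency (all_edges X))\<^sup>*" if "u \<in> X" "v \<in> X" for u v
    using that by (cases "u = v") (auto simp: adjacency_def all_edges_def)
  then show ?thesis using assms by (auto simp: graph_connected_def reachable_def)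
qed

section \<open>Edges of \<open>K\<^sub>4\<close>-hypercubes\<close>

text \<open>Uniqueness at the points of \<open>A\<close> makes the partner a function
  \<open>p\<close>, uniqueness at the points of \<open>B\<close> makes it injective, and existence
  there makes it surjective.\<close>

lemma perfect_matching_betweenE:
  assumes "perfect_matching_between A B M" "A \<inter> B = {}"
  obtains p where "bij_betw p A B" "M = (\<lambda>a. {a, p a}) ` A"
proof -
  have M: "M \<subseteq> {{a, b} | a b. a \<in> A \<and> b \<in> B}"
    and uniq: "\<And>v. v \<in> A \<union> B \<Longrightarrow> \<exists>!e. e \<in> M \<and> v \<in> e"
    using assms(1) by (auto simp: perfect_matching_between_def)
  have "\<forall>a\<in>A. \<exists>b. b \<in> B \<and> {a, b} \<in> M"
  proof
    fix a assume a: "a \<in> A"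
    then obtain e where e: "e \<in> M" "a \<in> e" using uniq[of a] by auto
    then obtain a' b where "e = {a', b}" "a' \<in> A" "b \<in> B" using M by blast
    with e a assms(2) show "\<exists>b. b \<in> B \<and> {a, b} \<in> M" by auto
  qed
  then obtain p where p: "\<And>a. a \<in> A \<Longrightarrow> p a \<in> B \<and> {a, p a} \<in> M" by metis
  have M_eq: "M = (\<lambda>a. {a, p a}) ` A"
  proof
    show "M \<subseteq> (\<lambda>a. {a, p a}) ` A"
    proof
      fix e assume e: "e \<in> M"
      then obtain a b where ab: "e = {a, b}" "a \<in> A" "b \<in> B" using M by blast
      then have "e = {a, p a}" using uniq[of a] p[of a] e by auto
      then show "e \<in> (\<lambda>a. {a, p a}) ` A" using ab by blast
    qed
  qed (use p in auto)
  have "inj_on p A"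
  proof (rule inj_onI)
    fix x y assume xy: "x \<in> A" "y \<in> A" "p x = p y"
    then have "{x, p x} = {y, p y}" using uniq[of "p x"] p[of x] p[of y] by auto
    then show "x = y" using xy p[of y] assms(2) by (auto simp: doubleton_eq_iff)
  qed
  moreover have "p ` A = B"
  proof
    show "B \<subseteq> p ` A"
    proof
      fix b assume b: "b \<in> B"
      then obtain e where "e \<in> M" "b \<in> e" using uniq[of b] by auto
      then obtain a where "a \<in> A" "b \<in> {a, p a}" using M_eq by auto
      then show "b \<in> p ` A" using b assms(2) by auto
    qed
  qed (use p in auto)
  ultimately have "bij_betw p A B" by (simp add: bij_betw_def)
  then show thesis using M_eq that by blast
qed

section \<open>Order, connectedness and regularity\<close>

lemma finite_all_edges: "finite V \<Longrightarrow> finite (all_edges V)"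
  by (simp add: all_edges_def)

lemma matching_edges_subset_all_edges:
  assumes "bij_betw p A B" "A \<inter> B = {}"
  shows "(\<lambda>a. {a, p a}) ` A \<subseteq> all_edges (A \<union> B)"
proof -
  have "p a \<in> B" "a \<noteq> p a" if "a \<in> A" for a
    using bij_betw_apply[OF assms(1) that] assms(2) that by auto
  then show ?thesis by (auto simp: all_edges_def)
qed

lemma K4_hypercube_basic:
  assumes "K4_hypercube n V E"
  shows "2 \<le> n \<and> finite V \<and> card V = 2 ^ n \<and> E \<subseteq> all_edges V \<and> graph_connected V E"
  using assms
proof (induction rule: K4_hypercube.induct)
  case (base V)
  then have "finite V" "V \<noteq> {}" by (auto simp: card_ge_0_finite)
  then show ?case using base by (simp add: graph_connected_complete)
next
  case (step n V0 E0 V1 E1 M)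
  obtain p where p: "bij_betw p V0 V1" "M = (\<lambda>a. {a, p a}) ` V0"
    using perfect_matching_betweenE[OF step.hyps(4,3)] .
  have "graph_connected (V1 \<union> V0) (E0 \<union> E1 \<union> M)"
  proof (rule graph_connected_Un)
    show "graph_connected V1 (E0 \<union> E1 \<union> M)"
      using step.IH by (auto intro: graph_connected_mono)
    show "\<exists>a\<in>V1. {b, a} \<in> E0 \<union> E1 \<union> M" if "b \<in> V0" for b
      using that p bij_betw_apply[OF p(1)] by blast
  qed
  moreover have "E0 \<union> E1 \<union> M \<subseteq> all_edges (V0 \<union> V1)"
    using step.IH matching_edges_subset_all_edges[OF p(1) step.hyps(3)] p(2)
    by (auto simp: all_edges_def)
  ultimately show ?case
    using step by (auto simp: card_Un_disjoint Un_commute)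
qed

lemma perfect_matching_between_commute:
  "perfect_matching_between A B M \<Longrightarrow> perfect_matching_between B A M"
proof -
  have "{{a, b} | a b. a \<in> A \<and> b \<in> B} = {{b, a} | b a. b \<in> B \<and> a \<in> A}"
    by (metis insert_commute)
  then show "perfect_matching_between A B M \<Longrightarrow> perfect_matching_between B A M"
    by (simp add: perfect_matching_between_def Un_commute)
qed

lemma K4_hypercube_degree:
  assumes "K4_hypercube n V E" "v \<in> V"
  shows "card {e \<in> E. v \<in> e} = n + 1"
  using assms
proof (induction rule: K4_hypercube.induct)
  case (base V)
  have "{e \<in> all_edges V. v \<in> e} = (\<lambda>w. {v, w}) ` (V - {v})"
    using base.prems by (auto simp: all_edges_def card_2_iff)
  moreover have "inj_on (\<lambda>w. {v, w}) (V - {v})"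
    by (auto simp: inj_on_def doubleton_eq_iff)
  ultimately show ?case using base by (simp add: card_image)
next
  case (step n V0 E0 V1 E1 M)
  \<comment> \<open>Stated for halves \<open>W0\<close>, \<open>W1\<close> in either order, so that
    it covers \<open>v\<close> in \<open>V0\<close> and in \<open>V1\<close>. The unique matching
    edge at \<open>v\<close> leaves \<open>W0\<close> and therefore adds exactly one to the
    degree.\<close>
  have *: "card {e \<in> A0 \<union> A1 \<union> M. v \<in> e} = Suc n + 1"
    if v: "v \<in> W0" and deg: "card {e \<in> A0. v \<in> e} = n + 1"
      and A: "A0 \<subseteq> all_edges W0" "A1 \<subseteq> all_edges W1" and disj: "W0 \<inter> W1 = {}"
      and M: "perfect_matching_between W0 W1 M"
    for W0 W1 A0 A1
  proof -
    obtain e where e: "{e \<in> M. v \<in> e} = {e}"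
      using M v unfolding perfect_matching_between_def by (elim conjE ballE[of _ _ v]) auto
    then have "e \<in> M" by auto
    then obtain a b where "e = {a, b}" "b \<in> W1"
      using M by (auto simp: perfect_matching_between_def)
    then have "\<not> e \<subseteq> W0" using disj by auto
    then have "e \<notin> A0" using A by (auto simp: all_edges_def)
    moreover have "v \<notin> f" if "f \<in> A1" for f
    proof -
      have "f \<subseteq> W1" using that A(2) by (auto simp: all_edges_def)
      then show ?thesis using v disj by blast
    qed
    then have "{e \<in> A0 \<union> A1 \<union> M. v \<in> e} = {e \<in> M. v \<in> e} \<union> {e \<in> A0. v \<in> e}"
      by blast
    then have "{e \<in> A0 \<union> A1 \<union> M. v \<in> e} = insert e {e \<in> A0. v \<in> e}"
      unfolding e by simp
    moreover have "finite {e \<in> A0. v \<in> e}"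
      using deg by (intro card_ge_0_finite) simp
    ultimately show ?thesis using deg by simp
  qed
  note sub = K4_hypercube_basic[OF step.hyps(1)] K4_hypercube_basic[OF step.hyps(2)]
  show ?case
  proof (cases "v \<in> V0")
    case True
    then show ?thesis using step sub by (intro *[of V0 E0 E1 V1]) auto
  next
    case False
    then have "card {e \<in> E1 \<union> E0 \<union> M. v \<in> e} = Suc n + 1"
      using step sub perfect_matching_between_commute[OF step.hyps(4)]
      by (intro *[of V1 E1 E0 V0]) auto
    then show ?thesis by (simp add: Un_commute)
  qed
qed

text \<open>Double counting of incidences between \<open>X\<close> and edges: a boundary edge has
  one end in \<open>X\<close>, an induced edge two.\<close>

lemma card_edge_boundary:
  assumes "K4_hypercube n V E" "X \<subseteq> V"
  shows "card (edge_boundary E X) + 2 * card (induced_edges E X) = (n + 1) * card X"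
proof -
  have fin: "finite V" "E \<subseteq> all_edges V" using K4_hypercube_basic[OF assms(1)] by auto
  then have finE: "finite E" using finite_all_edges finite_subset by blast
  have finX: "finite X" using fin assms(2) finite_subset by blast
  have split: "card (e \<inter> X) = of_bool (card (e \<inter> X) = 1) + 2 * of_bool (e \<subseteq> X)" if "e \<in> E" for e
  proof -
    have "card e = 2" using that fin(2) by (auto simp: all_edges_def)
    then obtain a b where "e = {a, b}" "a \<noteq> b" by (auto simp: card_2_iff)
    then show ?thesis by (cases "a \<in> X"; cases "b \<in> X") auto
  qed
  have "(n + 1) * card X = (\<Sum>v\<in>X. card {e \<in> E. v \<in> e})"
    using K4_hypercube_degree[OF assms(1)] assms(2) by (simp add: subset_iff)
  also have "\<dots> = (\<Sum>v\<in>X. \<Sum>e\<in>E. of_bool (v \<in> e))"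
    using finE by (simp add: sum.If_cases of_bool_def Int_def)
  also have "\<dots> = (\<Sum>e\<in>E. \<Sum>v\<in>X. of_bool (v \<in> e))"
    by (rule sum.swap)
  also have "\<dots> = (\<Sum>e\<in>E. card (e \<inter> X))"
    using finX by (simp add: sum.If_cases of_bool_def Int_def conj_commute)
  also have "\<dots> = (\<Sum>e\<in>E. of_bool (card (e \<inter> X) = 1) + 2 * of_bool (e \<subseteq> X))"
    using split by (rule sum.cong[OF refl])
  also have "\<dots> = card (edge_boundary E X) + 2 * card (induced_edges E X)"
    using finE by (simp add: sum.distrib sum_distrib_left[symmetric] edge_boundary_def
        induced_edges_def sum.If_cases of_bool_def Int_def)
  finally show ?thesis by simp
qed

lemma card_induced_edges_matching:
  assumes "bij_betw p V0 V1" "V0 \<inter> V1 = {}" "finite V0" "finite V1"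
    and "E0 \<subseteq> all_edges V0" "E1 \<subseteq> all_edges V1"
  shows "card (induced_edges (E0 \<union> E1 \<union> (\<lambda>a. {a, p a}) ` V0) X) =
    card (induced_edges E0 (X \<inter> V0)) + card (induced_edges E1 (X \<inter> V1)) +
    card {a \<in> X \<inter> V0. p a \<in> X}"
proof -
  define M' where "M' = (\<lambda>a. {a, p a}) ` {a \<in> X \<inter> V0. p a \<in> X}"
  have pV: "p a \<in> V1" "p a \<notin> V0" if "a \<in> V0" for a
    using bij_betw_apply[OF assms(1) that] assms(2) by auto
  have eq: "induced_edges (E0 \<union> E1 \<union> (\<lambda>a. {a, p a}) ` V0) X =
    induced_edges E0 (X \<inter> V0) \<union> induced_edges E1 (X \<inter> V1) \<union> M'"
    using assms(5,6) by (auto simp: induced_edges_def all_edges_def M'_def)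
  have "finite (induced_edges E0 (X \<inter> V0))" "finite (induced_edges E1 (X \<inter> V1))" "finite M'"
    using assms(3-6) finite_subset[OF _ finite_all_edges]
    by (auto simp: induced_edges_def M'_def)
  moreover have "induced_edges E0 (X \<inter> V0) \<inter> induced_edges E1 (X \<inter> V1) = {}"
  proof -
    have False if "e \<in> E0" "e \<subseteq> V0" "e \<subseteq> V1" for e
    proof -
      have "e = {}" using that assms(2) by blast
      then show False using that(1) assms(5) by (auto simp: all_edges_def)
    qed
    then show ?thesis by (auto simp: induced_edges_def)
  qed
  moreover have "(induced_edges E0 (X \<inter> V0) \<union> induced_edges E1 (X \<inter> V1)) \<inter> M' = {}"
    using pV assms(2) by (auto simp: induced_edges_def M'_def)
  moreover have "card M' = card {a \<in> X \<inter> V0. p a \<in> X}"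
    unfolding M'_def using pV by (intro card_image) (auto simp: inj_on_def doubleton_eq_iff)
  ultimately show ?thesis
    unfolding eq by (simp add: card_Un_disjoint)
qed

lemma card_induced_edges_all_edges:
  assumes "finite V" "X \<subseteq> V"
  shows "card (induced_edges (all_edges V) X) = card X choose 2"
proof -
  have "induced_edges (all_edges V) X = {e. e \<subseteq> X \<and> card e = 2}"
    using assms(2) by (auto simp: induced_edges_def all_edges_def)
  then show ?thesis using n_subsets[of X 2] finite_subset[OF assms(2,1)] by simp
qed

text \<open>The matching edges inside \<open>X\<close> number at most the smaller of its two parts,
  which is exactly the bonus term of \<open>max_edges_superadditive\<close>.\<close>

lemma card_induced_edges_le:
  assumes "K4_hypercube n V E" "X \<subseteq> V"
  shows "card (induced_edges E X) \<le> max_edges (card X)"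
  using assms
proof (induction arbitrary: X rule: K4_hypercube.induct)
  case (base V)
  then have "finite V" by (simp add: card_ge_0_finite)
  then show ?case
    using base card_mono[of V X] by (simp add: card_induced_edges_all_edges max_edges_le_4)
next
  case (step n V0 E0 V1 E1 M)
  note sub = K4_hypercube_basic[OF step.hyps(1)] K4_hypercube_basic[OF step.hyps(2)]
  obtain p where p: "bij_betw p V0 V1" "M = (\<lambda>a. {a, p a}) ` V0"
    using perfect_matching_betweenE[OF step.hyps(4,3)] .
  define X0 X1 where "X0 = X \<inter> V0" and "X1 = X \<inter> V1"
  have fin: "finite X0" "finite X1" using sub by (auto simp: X0_def X1_def)
  have "X = X0 \<union> X1" "X0 \<inter> X1 = {}"
    using step.prems step.hyps(3) by (auto simp: X0_def X1_def)
  then have cardX: "card X = card X0 + card X1" using fin card_Un_disjoint by metis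
  define m where "m = card {a \<in> X \<inter> V0. p a \<in> X}"
  have "m \<le> card X0" unfolding m_def X0_def using sub by (intro card_mono) auto
  moreover have "m \<le> card X1"
  proof -
    have "inj_on p {a \<in> X \<inter> V0. p a \<in> X}"
      using p(1) by (auto simp: bij_betw_def inj_on_def)
    moreover have "p ` {a \<in> X \<inter> V0. p a \<in> X} \<subseteq> X1"
      using bij_betw_apply[OF p(1)] by (auto simp: X1_def)
    ultimately show ?thesis unfolding m_def using fin(2) by (rule card_inj_on_le)
  qed
  moreover have "card (induced_edges (E0 \<union> E1 \<union> M) X) =
      card (induced_edges E0 X0) + card (induced_edges E1 X1) + m"
    unfolding p(2) X0_def X1_def m_def
    using card_induced_edges_matching[OF p(1) step.hyps(3)] sub by blast
  moreover have "card (induced_edges E0 X0) \<le> max_edges (card X0)"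
    "card (induced_edges E1 X1) \<le> max_edges (card X1)"
    by (auto intro!: step.IH simp: X0_def X1_def)
  ultimately show ?case
    using max_edges_superadditive[of "card X0" "card X1"]
      max_edges_superadditive[of "card X1" "card X0"] cardX
    by (cases "card X0 \<le> card X1") (simp_all add: add.commute)
qed

section \<open>Sets attaining the bound\<close>

lemma induced_edges_mono: "E \<subseteq> E' \<Longrightarrow> X \<subseteq> X' \<Longrightarrow> induced_edges E X \<subseteq> induced_edges E' X'"
  by (auto simp: induced_edges_def)

lemma induced_edges_self: "E \<subseteq> all_edges V \<Longrightarrow> induced_edges E V = E"
  by (auto simp: induced_edges_def all_edges_def)

text \<open>The set fills \<open>V0\<close> before it enters \<open>V1\<close>, recursively. The
  guards cover \<open>m = 0\<close> and \<open>m = 2 ^ n\<close>, since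
  \<open>graph_connected\<close> demands a nonempty vertex set.\<close>

lemma ex_optimal_set:
  assumes "K4_hypercube n V E" "m \<le> 2 ^ n"
  shows "\<exists>X\<subseteq>V. card X = m \<and> card (induced_edges E X) = max_edges m \<and>
    (X \<noteq> {} \<longrightarrow> graph_connected X (induced_edges E X)) \<and>
    (X \<noteq> V \<longrightarrow> graph_connected (V - X) (induced_edges E (V - X)))"
  using assms
proof (induction arbitrary: m rule: K4_hypercube.induct)
  case (base V)
  then have fin: "finite V" by (simp add: card_ge_0_finite)
  have conn: "graph_connected Y (induced_edges (all_edges V) Y)" if "Y \<subseteq> V" "Y \<noteq> {}" for Y
  proof -
    have "induced_edges (all_edges V) Y = all_edges Y"
      using that(1) by (auto simp: induced_edges_def all_edges_def)
    then show ?thesis using that(2) by (simp add: graph_connected_complete)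
  qed
  obtain X where X: "X \<subseteq> V" "card X = m"
    using base obtain_subset_with_card_n[of m V] by auto
  then have "card (induced_edges (all_edges V) X) = max_edges m"
    using base.prems by (simp add: card_induced_edges_all_edges[OF fin] max_edges_le_4)
  then show ?case using X conn[of X] conn[of "V - X"] by (intro exI[of _ X]) auto
next
  case (step n V0 E0 V1 E1 M)
  note sub = K4_hypercube_basic[OF step.hyps(1)] K4_hypercube_basic[OF step.hyps(2)]
  note disj = step.hyps(3)
  obtain p where p: "bij_betw p V0 V1" "M = (\<lambda>a. {a, p a}) ` V0"
    using perfect_matching_betweenE[OF step.hyps(4) disj] .
  let ?E = "E0 \<union> E1 \<union> M"
  have to_V1: "\<exists>a\<in>V1. {b, a} \<in> M" if "b \<in> V0" for b
    using that p bij_betw_apply[OF p(1)] by blast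
  have to_V0: "\<exists>a\<in>V0. {b, a} \<in> M" if "b \<in> V1" for b
  proof -
    obtain a where "a \<in> V0" "b = p a" using \<open>b \<in> V1\<close> p(1) by (auto simp: bij_betw_def)
    then show ?thesis using p(2) by (auto simp: insert_commute)
  qed
  \<comment> \<open>A full half stays connected when any part of the other half is attached by the
    matching. This form serves the complement when the set fits into \<open>V0\<close>; its mirror
    image \<open>conn_V0\<close> serves the set itself otherwise.\<close>
  have conn_V1: "graph_connected (V1 \<union> Y) (induced_edges ?E (V1 \<union> Y))" if "Y \<subseteq> V0" for Y
  proof (rule graph_connected_Un)
    show "graph_connected V1 (induced_edges ?E (V1 \<union> Y))"
    proof (rule graph_connected_mono[of V1 E1])
      have "induced_edges E1 V1 = E1" using sub by (simp add: induced_edges_self)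
      then show "E1 \<subseteq> induced_edges ?E (V1 \<union> Y)"
        using induced_edges_mono[of E1 ?E V1 "V1 \<union> Y"] by blast
    qed (use sub in simp)
    show "\<exists>a\<in>V1. {b, a} \<in> induced_edges ?E (V1 \<union> Y)" if "b \<in> Y" for b
    proof -
      have "b \<in> V0" using that \<open>Y \<subseteq> V0\<close> by blast
      then obtain a where "a \<in> V1" "{b, a} \<in> M" using to_V1 by blast
      then show ?thesis using that by (intro bexI[of _ a]) (simp_all add: induced_edges_def)
    qed
  qed
  have conn_V0: "graph_connected (V0 \<union> Y) (induced_edges ?E (V0 \<union> Y))" if "Y \<subseteq> V1" for Y
  proof (rule graph_connected_Un)
    show "graph_connected V0 (induced_edges ?E (V0 \<union> Y))"
    proof (rule graph_connected_mono[of V0 E0])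
      have "induced_edges E0 V0 = E0" using sub by (simp add: induced_edges_self)
      then show "E0 \<subseteq> induced_edges ?E (V0 \<union> Y)"
        using induced_edges_mono[of E0 ?E V0 "V0 \<union> Y"] by blast
    qed (use sub in simp)
    show "\<exists>a\<in>V0. {b, a} \<in> induced_edges ?E (V0 \<union> Y)" if "b \<in> Y" for b
    proof -
      have "b \<in> V1" using that \<open>Y \<subseteq> V1\<close> by blast
      then obtain a where "a \<in> V0" "{b, a} \<in> M" using to_V0 by blast
      then show ?thesis using that by (intro bexI[of _ a]) (simp_all add: induced_edges_def)
    qed
  qed
  have card_split: "card (induced_edges ?E X) =
      card (induced_edges E0 (X \<inter> V0)) + card (induced_edges E1 (X \<inter> V1)) +
      card {a \<in> X \<inter> V0. p a \<in> X}" for X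
    unfolding p(2) using card_induced_edges_matching[OF p(1) disj] sub by blast
  have empty: "induced_edges E0 {} = {}" "induced_edges E1 {} = {}"
    using sub by (auto simp: induced_edges_def all_edges_def)
  show ?case
  proof (cases "m \<le> 2 ^ n")
    case True
    then obtain X where X: "X \<subseteq> V0" "card X = m" "card (induced_edges E0 X) = max_edges m"
      "X \<noteq> {} \<longrightarrow> graph_connected X (induced_edges E0 X)"
      using step.IH(1)[of m] by auto
    have "X \<inter> V0 = X" "X \<inter> V1 = {}" using X(1) disj by auto
    moreover from this have "card {a \<in> X \<inter> V0. p a \<in> X} = 0"
      using bij_betw_apply[OF p(1)] by (metis (no_types, lifting) Int_iff card.empty empty_Collect_eq empty_iff)
    ultimately have "card (induced_edges ?E X) = max_edges m"
      unfolding card_split[of X] using X(3) by (simp only: empty card.empty)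
    moreover have "graph_connected X (induced_edges ?E X)" if "X \<noteq> {}"
      using X(4) that graph_connected_mono induced_edges_mono[of E0 ?E X X] by blast
    moreover have "(V0 \<union> V1) - X = V1 \<union> (V0 - X)" using X(1) disj by auto
    then have "graph_connected ((V0 \<union> V1) - X) (induced_edges ?E ((V0 \<union> V1) - X))"
      using conn_V1[of "V0 - X"] by simp
    ultimately show ?thesis using X(1,2) by (intro exI[of _ X]) auto
  next
    case False
    then obtain j where j: "m = 2 ^ n + j" by (metis le_Suc_ex nat_le_linear)
    then have "j \<le> 2 ^ n" using step.prems by simp
    then obtain Y where Y: "Y \<subseteq> V1" "card Y = j" "card (induced_edges E1 Y) = max_edges j"
      "Y \<noteq> V1 \<longrightarrow> graph_connected (V1 - Y) (induced_edges E1 (V1 - Y))"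
      using step.IH(2)[of j] by auto
    let ?X = "V0 \<union> Y"
    have finY: "finite Y" using Y(1) sub finite_subset by blast
    have disjY: "V0 \<inter> Y = {}" using Y(1) disj by auto
    have X_eq: "?X \<inter> V0 = V0" "?X \<inter> V1 = Y" using Y(1) disj by auto
    \<comment> \<open>Each vertex of \<open>Y\<close> has its partner in the full half
      \<open>V0\<close>, so exactly \<open>j\<close> matching edges lie inside the set.\<close>
    have "bij_betw p {a \<in> V0. p a \<in> Y} Y"
      using p(1) Y(1) unfolding bij_betw_def inj_on_def by blast
    moreover have "{a \<in> ?X \<inter> V0. p a \<in> ?X} = {a \<in> V0. p a \<in> Y}"
      using bij_betw_apply[OF p(1)] disj by auto
    ultimately have "card {a \<in> ?X \<inter> V0. p a \<in> ?X} = j"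
      using Y(2) bij_betw_same_card by metis
    \<comment> \<open>A set of \<open>2 ^ n\<close> vertices of \<open>V0\<close> is
      \<open>V0\<close> itself, so the induction hypothesis gives the exact edge count of the full
      half.\<close>
    moreover obtain X0 where "X0 \<subseteq> V0" "card X0 = 2 ^ n"
      "card (induced_edges E0 X0) = max_edges (2 ^ n)"
      using step.IH(1)[of "2 ^ n"] by auto
    then have "card (induced_edges E0 V0) = max_edges (2 ^ n)"
      using card_subset_eq[of V0 X0] sub by auto
    ultimately have "card (induced_edges ?E ?X) = max_edges m"
      using card_split[of ?X] Y(3) max_edges_power_add[of n j] sub \<open>j \<le> 2 ^ n\<close> j
      by (simp only: X_eq)
    moreover have "card ?X = m"
      using j Y(2) sub disjY finY by (simp add: card_Un_disjoint)
    moreover have "graph_connected ?X (induced_edges ?E ?X)" using conn_V0[OF Y(1)] .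
    moreover have "graph_connected ((V0 \<union> V1) - ?X) (induced_edges ?E ((V0 \<union> V1) - ?X))"
      if "?X \<noteq> V0 \<union> V1"
    proof -
      have "(V0 \<union> V1) - ?X = V1 - Y" using disj by auto
      moreover have "graph_connected (V1 - Y) (induced_edges E1 (V1 - Y))"
        using Y(4) that by auto
      ultimately show ?thesis
        using graph_connected_mono induced_edges_mono[of E1 ?E "V1 - Y" "V1 - Y"] by simp blast
    qed
    ultimately show ?thesis using Y(1) by (intro exI[of _ ?X]) auto
  qed
qed

section \<open>Extra edge-connectivity\<close>

text \<open>Regularity turns the upper bound on induced edges into a lower bound on the boundary. It
  covers arbitrary \<open>X\<close>, hence also the sets arising from extra edge cuts.\<close>

lemma card_edge_boundary_ge:
  assumes "K4_hypercube n V E" "X \<subseteq> V"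
  shows "min_boundary (n + 1) (card X) \<le> int (card (edge_boundary E X))"
proof -
  have "int (card (edge_boundary E X)) + 2 * int (card (induced_edges E X)) = int (n + 1) * int (card X)"
    using card_edge_boundary[OF assms] by (metis of_nat_add of_nat_mult of_nat_numeral)
  then show ?thesis
    using card_induced_edges_le[OF assms] by (simp add: min_boundary_def)
qed

lemma ex_xi_feasible_min_boundary:
  assumes "K4_hypercube n V E" "1 \<le> m" "m < 2 ^ n"
  obtains X where "xi_feasible m V E X" "int (card (edge_boundary E X)) = min_boundary (n + 1) m"
proof -
  obtain X where X: "X \<subseteq> V" "card X = m" "card (induced_edges E X) = max_edges m"
    "X \<noteq> {} \<longrightarrow> graph_connected X (induced_edges E X)"
    "X \<noteq> V \<longrightarrow> graph_connected (V - X) (induced_edges E (V - X))"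
    using ex_optimal_set[OF assms(1)] assms(3) by (metis less_imp_le)
  have "X \<noteq> {}" "X \<noteq> V"
    using X(2) assms(2,3) K4_hypercube_basic[OF assms(1)] by auto
  then have "xi_feasible m V E X" using X by (simp add: xi_feasible_def)
  moreover have "int (card (edge_boundary E X)) + 2 * int (max_edges m) = int (n + 1) * int m"
    using card_edge_boundary[OF assms(1) X(1)] X(2,3) by (metis of_nat_add of_nat_mult of_nat_numeral)
  ultimately show thesis using that by (simp add: min_boundary_def)
qed

text \<open>An edge leaving \<open>X\<close> has exactly one end in \<open>X\<close> and has been
  deleted, so no path escapes.\<close>

lemma reachable_edge_boundary:
  assumes "(u, v) \<in> (adjacency (E - edge_boundary E X))\<^sup>*" "u \<in> X" "E \<subseteq> all_edges V"
  shows "v \<in> X"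
  using assms(1,2)
proof (induction rule: rtrancl_induct)
  case (step y z)
  then have yz: "{y, z} \<in> E" "card ({y, z} \<inter> X) \<noteq> 1" "y \<in> X"
    by (auto simp: adjacency_def edge_boundary_def)
  show ?case
  proof (rule ccontr)
    assume "z \<notin> X"
    then have "{y, z} \<inter> X = {y}" using yz(3) by auto
    then show False using yz(2) by simp
  qed
qed

text \<open>After deletion of the boundary, every component contains all of \<open>X\<close> or all
  of \<open>V - X\<close>, and both have at least \<open>h\<close> vertices.\<close>

lemma extra_edge_cut_edge_boundary:
  assumes "E \<subseteq> all_edges V" "finite V" "xi_feasible h V E X" "h \<le> card (V - X)"
  shows "extra_edge_cut h V E (edge_boundary E X)"
proof -
  let ?E = "E - edge_boundary E X"
  have X: "X \<subseteq> V" "card X = h" "graph_connected X (induced_edges E X)"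
    "graph_connected (V - X) (induced_edges E (V - X))"
    using assms(3) by (auto simp: xi_feasible_def)
  \<comment> \<open>Here \<open>?E\<close> is the whole surviving edge set: what matters is that the
    vertices of each side are mutually reachable in the remaining graph.\<close>
  have conn: "graph_connected X ?E" "graph_connected (V - X) ?E"
  proof -
    have card2: "card e = 2" if "e \<in> E" for e
      using assms(1) that by (auto simp: all_edges_def)
    have "e \<inter> X = e" if "e \<subseteq> X" for e using that by blast
    then have "induced_edges E X \<subseteq> ?E"
      using card2 by (auto simp: induced_edges_def edge_boundary_def)
    then show "graph_connected X ?E" using X(3) graph_connected_mono by blast
    have "e \<inter> X = {}" if "e \<subseteq> V - X" for e using that by blast
    then have "induced_edges E (V - X) \<subseteq> ?E"
      using card2 by (auto simp: induced_edges_def edge_boundary_def)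
    then show "graph_connected (V - X) ?E" using X(4) graph_connected_mono by blast
  qed
  obtain u v where uv: "u \<in> X" "v \<in> V - X" using conn by (auto simp: graph_connected_def)
  have "\<not> graph_connected V ?E"
  proof
    assume "graph_connected V ?E"
    then have "(u, v) \<in> (adjacency ?E)\<^sup>*"
      using uv X(1) by (auto simp: graph_connected_def reachable_def)
    then show False using reachable_edge_boundary[OF _ uv(1) assms(1)] uv(2) by blast
  qed
  moreover have "h \<le> card C" if "C \<in> graph_components V ?E" for C
  proof -
    obtain w where w: "w \<in> V" "C = reachable V ?E `` {w}"
      using \<open>C \<in> graph_components V ?E\<close> by (auto simp: graph_components_def elim: quotientE)
    have "C \<subseteq> V" using w(2) by (auto simp: reachable_def)
    then have finC: "finite C" using assms(2) finite_subset by blast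
    show ?thesis
    proof (cases "w \<in> X")
      case True
      then have "X \<subseteq> C" using conn(1) X(1) w by (auto simp: graph_connected_def reachable_def)
      then show ?thesis using card_mono[OF finC] X(2) by blast
    next
      case False
      then have "V - X \<subseteq> C" using conn(2) w by (auto simp: graph_connected_def reachable_def)
      then show ?thesis using card_mono[OF finC] assms(4) by (meson le_trans)
    qed
  qed
  ultimately show ?thesis by (auto simp: extra_edge_cut_def edge_boundary_def)
qed

text \<open>All edges leaving a component \<open>C\<close> lie in \<open>F\<close>, and a second
  component \<open>D\<close> shows that \<open>V - C\<close> is also large enough. Since
  \<open>C\<close> and \<open>V - C\<close> have the same boundary, the side with at most half of
  the vertices can be chosen.\<close>

lemma extra_edge_cut_contains_boundary:
  assumes "E \<subseteq> all_edges V" "finite V" "V \<noteq> {}" "extra_edge_cut h V E F"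
  obtains X where "X \<subseteq> V" "h \<le> card X" "2 * card X \<le> card V" "edge_boundary E X \<subseteq> F"
proof -
  let ?R = "reachable V (E - F)"
  have "\<not> graph_connected V (E - F)" and comp: "\<And>C. C \<in> V // ?R \<Longrightarrow> h \<le> card C"
    using assms(4) by (auto simp: extra_edge_cut_def graph_components_def)
  then obtain u v where uv: "u \<in> V" "v \<in> V" "(u, v) \<notin> ?R"
    using assms(3) by (auto simp: graph_connected_def)
  define C D where "C = ?R `` {u}" and "D = ?R `` {v}"
  have CV: "C \<subseteq> V" "D \<subseteq> V" by (auto simp: C_def D_def reachable_def)
  have "C \<inter> D = {}"
    using uv(3) equiv_reachable[of V "E - F"] unfolding C_def D_def
    by (auto dest: equiv_class_eq[OF equiv_reachable] simp: equiv_class_eq_iff[OF equiv_reachable])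
  then have "D \<subseteq> V - C" using CV by auto
  moreover have "h \<le> card C" "h \<le> card D"
    using comp uv by (auto simp: C_def D_def intro: quotientI)
  ultimately have hC: "h \<le> card C" "h \<le> card (V - C)"
    using card_mono[of "V - C" D] assms(2) by auto
  have bdC: "edge_boundary E C \<subseteq> F"
  proof
    fix e assume e: "e \<in> edge_boundary E C"
    then obtain a b where ab: "e = {a, b}" "e \<in> E" "a \<in> V" "b \<in> V"
      using assms(1) by (fastforce simp: edge_boundary_def all_edges_def card_2_iff)
    show "e \<in> F"
    proof (rule ccontr)
      assume "e \<notin> F"
      then have "(a, b) \<in> adjacency (E - F)" using ab by (simp add: adjacency_def)
      then have "(a, b) \<in> ?R" using ab by (auto simp: reachable_def)
      then have "a \<in> C \<longleftrightarrow> b \<in> C"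
        unfolding C_def using equiv_reachable[of V "E - F"]
        by (meson Image_singleton_iff equivE symD transD)
      then have "e \<inter> C = {} \<or> e \<inter> C = e" using ab(1) by auto
      moreover have "card e = 2" using ab(2) assms(1) by (auto simp: all_edges_def)
      ultimately show False using e by (auto simp: edge_boundary_def)
    qed
  qed
  have "edge_boundary E (V - C) = edge_boundary E C"
  proof -
    have "card (e \<inter> (V - C)) = 1 \<longleftrightarrow> card (e \<inter> C) = 1" if "e \<in> E" for e
    proof -
      have e: "e \<subseteq> V" "card e = 2" using that assms(1) by (auto simp: all_edges_def)
      then have "finite e" by (intro card_ge_0_finite) simp
      moreover have "e \<inter> (V - C) = e - C" using e(1) by auto
      ultimately have "card (e \<inter> (V - C)) + card (e \<inter> C) = 2"
        using card_Diff_subset_Int[of e C] card_mono[of e "e \<inter> C"] e(2) by auto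
      then show ?thesis by linarith
    qed
    then show ?thesis by (auto simp: edge_boundary_def)
  qed
  then show thesis
  proof (cases "2 * card C \<le> card V")
    case False
    then have "2 * card (V - C) \<le> card V"
      using card_Diff_subset[of C V] CV assms(2) finite_subset by fastforce
    then show thesis using that[of "V - C"] hC bdC \<open>edge_boundary E (V - C) = _\<close> by auto
  qed (use that[of C] hC bdC CV in auto)
qed

theorem theorem1:
  fixes n h \<gamma> :: nat and V :: "'a set" and E :: "'a set set"
  assumes "n \<ge> 3"
    and "\<gamma> = (if even n then 0 else 1)"
    and "K4_hypercube n V E"
    and "1 \<le> h"
    and "h \<le> 2 ^ nat \<lceil>real n / 2\<rceil> - 2 - \<gamma>"
  shows "(\<exists>F. extra_edge_cut h V E F) \<and> (\<exists>X. xi_feasible h V E X) \<and>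
         extra_edge_connectivity h V E = xi h V E"
proof -
  note basic = K4_hypercube_basic[OF assms(3)]
  then have finE: "finite E" using finite_all_edges finite_subset by blast
  define c where "c = (n + 1) div 2"
  have "\<lceil>real n / 2\<rceil> = int c"
    unfolding c_def by (cases "even n") (auto elim!: evenE oddE simp: ceiling_eq_iff)
  \<comment> \<open>As \<open>1 \<le> h\<close>, the natural subtraction in the bound is not
    truncated and can be moved to the left.\<close>
  then have h: "h + 2 + n mod 2 \<le> 2 ^ c"
    using assms(2,4,5) by (cases "even n") (auto simp: odd_iff_mod_2_eq_one)
  have "(2::nat) ^ c \<le> 2 ^ (n - 1)"
    using assms(1) by (intro power_increasing) (auto simp: c_def)
  moreover have "2 * 2 ^ (n - 1) = (2::nat) ^ n"
    using assms(1) by (cases n) auto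
  ultimately have h_half: "2 * h < 2 ^ n" using h by linarith
  then have "h < 2 ^ n" by simp
  \<comment> \<open>This one \<open>X\<close> attains both minima. It also shows that neither
    infimum is the default \<open>0\<close> of an empty set.\<close>
  then obtain X where X: "xi_feasible h V E X"
    and bd: "int (card (edge_boundary E X)) = min_boundary (n + 1) h"
    using ex_xi_feasible_min_boundary[OF assms(3,4)] by blast
  have "card (V - X) = 2 ^ n - h"
    using X basic card_Diff_subset[of X V] finite_subset[of X V] by (auto simp: xi_feasible_def)
  then have cut: "extra_edge_cut h V E (edge_boundary E X)"
    using X basic h_half by (intro extra_edge_cut_edge_boundary) auto
  have "xi h V E = card (edge_boundary E X)"
    unfolding xi_def
  proof (rule cInf_eq_minimum)
    fix k assume "k \<in> {card (edge_boundary E Y) | Y. xi_feasible h V E Y}"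
    then obtain Y where "k = card (edge_boundary E Y)" "Y \<subseteq> V" "card Y = h"
      by (auto simp: xi_feasible_def)
    then show "card (edge_boundary E X) \<le> k"
      using card_edge_boundary_ge[OF assms(3), of Y] bd by simp
  qed (use X in blast)
  moreover have "extra_edge_connectivity h V E = card (edge_boundary E X)"
    unfolding extra_edge_connectivity_def
  proof (rule cInf_eq_minimum)
    fix k assume "k \<in> {card F | F. extra_edge_cut h V E F}"
    then obtain F where F: "k = card F" "extra_edge_cut h V E F" by blast
    have "V \<noteq> {}" using basic by auto
    then obtain Y where Y: "Y \<subseteq> V" "h \<le> card Y" "2 * card Y \<le> card V" "edge_boundary E Y \<subseteq> F"
      using extra_edge_cut_contains_boundary[OF _ _ _ F(2)] basic by metis
    \<comment> \<open>The choice of the smaller side keeps \<open>card Y\<close> in the range where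
      \<open>min_boundary_mono\<close> applies.\<close>
    have "card Y \<le> 2 ^ (n - 1)"
      using Y(3) basic \<open>2 * 2 ^ (n - 1) = (2::nat) ^ n\<close> by linarith
    then have "min_boundary (n + 1) h \<le> min_boundary (n + 1) (card Y)"
      using min_boundary_mono[OF assms(1) c_def h Y(2)] by blast
    also have "\<dots> \<le> int (card (edge_boundary E Y))"
      using card_edge_boundary_ge[OF assms(3) Y(1)] .
    also have "card (edge_boundary E Y) \<le> card F"
      using F(2) Y(4) finE finite_subset by (intro card_mono) (auto simp: extra_edge_cut_def)
    finally show "card (edge_boundary E X) \<le> k" using bd F(1) by simp
  qed (use cut in blast)
  ultimately show ?thesis using X cut by auto
qed

end
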